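(* Let $q$ be a prime power, let $d\ge1$ and $k$ be integers such that $d+1$ is a proper divisor of $k+1$, and write $\theta(m)=\frac{q^{m+1}-1}{q-1}$. Then there exists a J-optimal $\left(\frac{\theta(k)}{\theta(d)}\times\theta(d),\,q+1,\,0,\,1\right)$ 2-D OOC.
   Context: A $(\Lambda\times T,w,\lambda_a,\lambda_c)$ 2-D optical orthogonal code (2-D OOC) is a nonempty set $C$ of $\Lambda\times T$ binary ($0/1$) arrays $A=(a_{i,j})$, $0\le i\le\Lambda-1$, $0\le j\le T-1$, each with exactly $w$ entries equal to $1$, such that (second subscript modulo $T$): (i) $\sum_{i,j}a_{i,j}a_{i,j+t}\le\lambda_a$ for every $A\in C$ and $1\le t\le T-1$; (ii) $\sum_{i,j}a_{i,j}b_{i,j+t}\le\lambda_c$ for all distinct $A,B\in C$ and $0\le t\le T-1$. The sums run over all $i,j$. The code is ideal if $\lambda_a=0$. A code is J-optimal if its size meets the applicable Johnson-type upper bound. For an ideal $(\Lambda\times T,w,0,\lambda_c)$ code with $N=\Lambda T$ the bound is $$|C|\le\left\lfloor\frac{N}{Tw}\left\lfloor\frac{N-T}{w-1}\left\lfloor\cdots\left\lfloor\frac{N-\lambda_cT}{w-\lambda_c}\right\rfloor\cdots\right\rfloor\right\rfloor\right\rfloor ,$$ which for $\lambda_c=1$ reads $|C|\le\left\lfloor\frac{N}{Tw}\left\lfloor\frac{N-T}{w-1}\right\rfloor\right\rfloor$; J-optimal means that equality holds. *)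

theory Defs
  imports "HOL-Library.FuncSet" "HOL-Number_Theory.Prime_Powers"
begin

definition binary_arrays :: "nat \<Rightarrow> nat \<Rightarrow> (nat \<times> nat \<Rightarrow> nat) set" where
  "binary_arrays L T = ({..<L} \<times> {..<T}) \<rightarrow>\<^sub>E {0, 1}"

definition array_weight :: "nat \<Rightarrow> nat \<Rightarrow> (nat \<times> nat \<Rightarrow> nat) \<Rightarrow> nat" where
  "array_weight L T A = card {p \<in> {..<L} \<times> {..<T}. A p = 1}"

definition correlation ::
  "nat \<Rightarrow> nat \<Rightarrow> (nat \<times> nat \<Rightarrow> nat) \<Rightarrow> (nat \<times> nat \<Rightarrow> nat) \<Rightarrow> nat \<Rightarrow> nat" where
  "correlation L T A B t = (\<Sum>i<L. \<Sum>j<T. A (i, j) * B (i, (j + t) mod T))"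

definition ooc_2d ::
  "nat \<Rightarrow> nat \<Rightarrow> nat \<Rightarrow> nat \<Rightarrow> nat \<Rightarrow> (nat \<times> nat \<Rightarrow> nat) set \<Rightarrow> bool" where
  "ooc_2d L T w la lc C \<longleftrightarrow>
     C \<noteq> {} \<and> C \<subseteq> binary_arrays L T \<and>
     (\<forall>A\<in>C. array_weight L T A = w) \<and>
     (\<forall>A\<in>C. \<forall>t\<in>{1..<T}. correlation L T A A t \<le> la) \<and>
     (\<forall>A\<in>C. \<forall>B\<in>C. A \<noteq> B \<longrightarrow> (\<forall>t\<in>{..<T}. correlation L T A B t \<le> lc))"

text \<open>
  The \<open>n\<close> nested floors with numerators \<open>N - i T, N - (i + 1) T, \<dots>\<close> and denominators
  \<open>w - i, w - (i + 1), \<dots>\<close>, counted from the outside; the empty nesting is \<open>1\<close>.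
\<close>

primrec johnson_nest :: "nat \<Rightarrow> nat \<Rightarrow> nat \<Rightarrow> nat \<Rightarrow> nat \<Rightarrow> int" where
  "johnson_nest N T w i 0 = 1"
| "johnson_nest N T w i (Suc n) =
     \<lfloor>(real N - real i * real T) / (real w - real i) * real_of_int (johnson_nest N T w (Suc i) n)\<rfloor>"

definition johnson_bound_ideal :: "nat \<Rightarrow> nat \<Rightarrow> nat \<Rightarrow> nat \<Rightarrow> int" where
  "johnson_bound_ideal L T w lc =
     (let N = L * T in \<lfloor>real N / (real T * real w) * real_of_int (johnson_nest N T w 1 lc)\<rfloor>)"

lemma johnson_bound_ideal_1:
  "johnson_bound_ideal L T w 1 =
     \<lfloor>real (L * T) / (real T * real w) *
        real_of_int \<lfloor>(real (L * T) - real T) / (real w - 1)\<rfloor>\<rfloor>"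
  by (simp add: johnson_bound_ideal_def Let_def)

definition J_optimal_ideal_ooc_2d ::
  "nat \<Rightarrow> nat \<Rightarrow> nat \<Rightarrow> nat \<Rightarrow> (nat \<times> nat \<Rightarrow> nat) set \<Rightarrow> bool" where
  "J_optimal_ideal_ooc_2d L T w lc C \<longleftrightarrow>
     ooc_2d L T w 0 lc C \<and> int (card C) = johnson_bound_ideal L T w lc"

definition theta :: "nat \<Rightarrow> nat \<Rightarrow> nat" where
  "theta q m = (q ^ (m + 1) - 1) div (q - 1)"

text \<open>
  The natural-number divisions in \<open>theta q m\<close> and \<open>theta q k div theta q d\<close> leave no remainder
  under the hypotheses of the theorem.
\<close>

lemma power_minus_1_dvd:
  fixes q :: nat
  assumes "a dvd b"
  shows "q ^ a - 1 dvd q ^ b - 1"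
proof (cases "q = 0")
  case True
  then show ?thesis using assms by (cases "a = 0"; cases "b = 0") (auto simp: zero_power)
next
  case False
  obtain c where b: "b = a * c" using assms by blast
  have "int (q ^ a) - 1 dvd int (q ^ a) ^ c - 1"
    using power_diff_1_eq[of "int (q ^ a)" c] by simp
  then have "int (q ^ a - 1) dvd int (q ^ b - 1)"
    using False by (simp add: b power_mult of_nat_diff Suc_leI)
  then show ?thesis by presburger
qed

lemma theta_mult: "theta q m * (q - 1) = q ^ (m + 1) - 1"
  using power_minus_1_dvd[of 1 "m + 1" q] by (simp add: theta_def)

lemma theta_dvd_theta:
  assumes "2 \<le> q" "d + 1 dvd k + 1"
  shows "theta q d dvd theta q k"
proof -
  have "theta q d * (q - 1) dvd theta q k * (q - 1)"
    unfolding theta_mult using assms(2) by (rule power_minus_1_dvd)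
  then show ?thesis using assms(1) by simp
qed

end

theory Submission
  imports
    Defs
    "HOL-Algebra.Algebraic_Closure"
    "HOL-Algebra.Multiplicative_Group"
    "HOL-Number_Theory.Residues"
begin

text \<open>
  Let \<open>F\<close> be the field with \<open>q ^ (k + 1)\<close> elements. As \<open>d + 1\<close> divides \<open>k + 1\<close>, it contains the
  fields \<open>K \<subseteq> M\<close> with \<open>q\<close> and \<open>q ^ (d + 1)\<close> elements. The \<open>theta q k\<close> classes of nonzero
  elements of \<open>F\<close> modulo \<open>K\<close> are the points of a projective space, and multiplication by a
  generator \<open>\<alpha>\<close> of the multiplicative group permutes them in a single cycle. Put
  \<open>T = theta q d\<close> and \<open>L = theta q k div T\<close>, and let the cell \<open>(i, j)\<close> of an \<open>L \<times> T\<close> array stand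
  for the point of \<open>\<alpha> ^ (i + L * j)\<close>. Then multiplication by \<open>\<alpha> ^ L\<close> is the cyclic shift of all
  rows, and two points lie in the same row exactly if they are proportional over \<open>M\<close>: the rows are
  a spread of subspaces.

  The codewords come from the projective lines spanned by two elements that are independent over
  \<open>M\<close>. Such a line has \<open>q + 1\<close> points, and any two of them are again independent over \<open>M\<close>, so that
  it meets every row at most once (\<open>indep2_over_extension\<close>). Two cells in different rows lie on
  exactly one of these lines. Hence the lines form a group divisible design with the rows as groups,
  and the row shift acts on it (\<open>cyclic_row_design_transversal_lines\<close>).

  Every design of this kind yields an optimal ideal code (\<open>ex_J_optimal_code\<close>). A shift moves each
  cell inside its row, so a block is disjoint from its nontrivial shifts: the autocorrelation is
  \<open>0\<close> and all orbits have length \<open>T\<close>. Choosing one block from each orbit makes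
  all shifts of different codewords distinct blocks, which share at most one cell. Counting the
  pairs of cells in different rows gives the number of blocks, and dividing it by \<open>T\<close> gives
  the Johnson bound, in which all roundings are exact.

  The field \<open>F\<close> and its subfields are obtained as fixed points of powers of the Frobenius map in an
  algebraic closure of the prime field (\<open>ex_finite_field\<close>).
\<close>

section \<open>Codes from row-cyclic designs\<close>

definition row_shift :: "nat \<Rightarrow> nat \<Rightarrow> nat \<times> nat \<Rightarrow> nat \<times> nat" where
  "row_shift T t p = (fst p, (snd p + t) mod T)"

lemma row_shift_simp [simp]: "row_shift T t (i, j) = (i, (j + t) mod T)"
  by (simp add: row_shift_def)

lemma row_shift_add: "row_shift T s (row_shift T t p) = row_shift T (t + s) p"
  by (cases p) (simp add: mod_simps ac_simps)

lemma row_shift_image_add: "row_shift T s ` row_shift T t ` A = row_shift T (t + s) ` A"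
  by (simp add: image_image row_shift_add)

lemma row_shift_mod: "row_shift T (t mod T) = row_shift T t"
  by (auto simp: row_shift_def mod_simps fun_eq_iff)

lemma row_shift_period:
  assumes "A \<subseteq> I \<times> {..<T}"
  shows "row_shift T (T * n) ` A = A"
proof -
  have "row_shift T (T * n) p = p" if "p \<in> A" for p
    using that assms by (cases p) (auto simp: mod_simps)
  then show ?thesis by simp
qed

lemma inj_on_row_shift: "inj_on (row_shift T t) (I \<times> {..<T})"
proof (rule inj_onI, clarsimp)
  fix j j' assume "j < T" "j' < T" "(j + t) mod T = (j' + t) mod T"
  then have "[j + t = j' + t] (mod T)" by (simp only: cong_def)
  then have "[j = j'] (mod T)" by (simp only: cong_add_rcancel_nat)
  then show "j = j'" using \<open>j < T\<close> \<open>j' < T\<close> by (simp add: cong_def)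
qed

definition indicator_array :: "nat \<Rightarrow> nat \<Rightarrow> (nat \<times> nat) set \<Rightarrow> nat \<times> nat \<Rightarrow> nat" where
  "indicator_array L T A = (\<lambda>p\<in>{..<L} \<times> {..<T}. if p \<in> A then 1 else 0)"

lemma indicator_array_in_binary_arrays: "indicator_array L T A \<in> binary_arrays L T"
  by (auto simp: indicator_array_def binary_arrays_def)

lemma inj_on_indicator_array: "inj_on (indicator_array L T) (Pow ({..<L} \<times> {..<T}))"
proof (rule inj_onI)
  fix A B
  assume AB: "A \<in> Pow ({..<L} \<times> {..<T})" "B \<in> Pow ({..<L} \<times> {..<T})"
    and eq: "indicator_array L T A = indicator_array L T B"
  have "p \<in> A \<longleftrightarrow> p \<in> B" if "p \<in> {..<L} \<times> {..<T}" for p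
    using fun_cong[OF eq, of p] that by (simp add: indicator_array_def split: if_splits)
  then show "A = B" using AB by blast
qed

lemma array_weight_indicator_array:
  assumes "A \<subseteq> {..<L} \<times> {..<T}"
  shows "array_weight L T (indicator_array L T A) = card A"
proof -
  have "{p \<in> {..<L} \<times> {..<T}. indicator_array L T A p = 1} = A"
    using assms by (auto simp: indicator_array_def split: if_splits)
  then show ?thesis by (simp add: array_weight_def)
qed

lemma correlation_indicator_array:
  assumes "A \<subseteq> {..<L} \<times> {..<T}"
  shows "correlation L T (indicator_array L T A) (indicator_array L T B) t
    = card {p \<in> A. row_shift T t p \<in> B}"
proof -
  let ?P = "{..<L} \<times> {..<T}"
  have "correlation L T (indicator_array L T A) (indicator_array L T B) t
    = (\<Sum>p\<in>?P. indicator_array L T A p * indicator_array L T B (row_shift T t p))"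
    by (simp add: correlation_def sum.cartesian_product split_def row_shift_def)
  also have "\<dots> = (\<Sum>p\<in>?P. if p \<in> {p \<in> A. row_shift T t p \<in> B} then 1 else 0)"
    by (intro sum.cong) (auto simp: indicator_array_def)
  also have "\<dots> = card (?P \<inter> {p \<in> A. row_shift T t p \<in> B})"
    by (subst sum.inter_restrict[symmetric]) simp_all
  also have "?P \<inter> {p \<in> A. row_shift T t p \<in> B} = {p \<in> A. row_shift T t p \<in> B}"
    using assms by blast
  finally show ?thesis .
qed

text \<open>
  A group divisible design with index \<open>1\<close> on the cells of an \<open>L \<times> T\<close> array: the groups are the
  rows, and the cyclic shift of all rows is an automorphism.
\<close>

locale cyclic_row_design =
  fixes L T w :: nat and Bs :: "(nat \<times> nat) set set"
  assumes rows: "2 \<le> L" and columns: "1 \<le> T" and weight: "2 \<le> w"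
    and block_cells: "B \<in> Bs \<Longrightarrow> B \<subseteq> {..<L} \<times> {..<T}"
    and block_card: "B \<in> Bs \<Longrightarrow> card B = w"
    and block_rows: "\<lbrakk>B \<in> Bs; p \<in> B; p' \<in> B; fst p = fst p'\<rbrakk> \<Longrightarrow> p = p'"
    and block_ex: "\<lbrakk>p \<in> {..<L} \<times> {..<T}; p' \<in> {..<L} \<times> {..<T}; fst p \<noteq> fst p'\<rbrakk>
      \<Longrightarrow> \<exists>B\<in>Bs. p \<in> B \<and> p' \<in> B"
    and block_unique: "\<lbrakk>A \<in> Bs; B \<in> Bs; p \<in> A \<inter> B; p' \<in> A \<inter> B; p \<noteq> p'\<rbrakk> \<Longrightarrow> A = B"
    and block_shift: "B \<in> Bs \<Longrightarrow> row_shift T t ` B \<in> Bs"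
begin

lemma finite_blocks: "finite Bs"
proof (rule finite_subset)
  show "Bs \<subseteq> Pow ({..<L} \<times> {..<T})" using block_cells by blast
qed simp

lemma finite_block: "B \<in> Bs \<Longrightarrow> finite B"
  using block_cells finite_subset by blast

text \<open>
  Every ordered pair of cells in different rows lies in exactly one block, and a block with \<open>w\<close> cells
  contains \<open>w * (w - 1)\<close> such pairs.
\<close>

lemma block_count: "card Bs * (w * (w - 1)) = L * T * (L * T - T)"
proof -
  let ?P = "{..<L} \<times> {..<T}"
  let ?D = "SIGMA p:?P. ({..<L} - {fst p}) \<times> {..<T}"
  have D: "?D = (\<Union>B\<in>Bs. B \<times> B - Id)"
  proof (intro equalityI subsetI)
    fix x assume "x \<in> ?D"
    then obtain p p' where x: "x = (p, p')" and p: "p \<in> ?P" "p' \<in> ?P" "fst p \<noteq> fst p'"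
      by (cases x) auto
    obtain B where "B \<in> Bs" "p \<in> B" "p' \<in> B" using block_ex[OF p] by blast
    moreover have "p \<noteq> p'" using p(3) by blast
    ultimately show "x \<in> (\<Union>B\<in>Bs. B \<times> B - Id)" unfolding x by blast
  next
    fix x assume "x \<in> (\<Union>B\<in>Bs. B \<times> B - Id)"
    then obtain B where "B \<in> Bs" "x \<in> B \<times> B - Id" by blast
    then obtain p p' where x: "x = (p, p')" and B: "B \<in> Bs" "p \<in> B" "p' \<in> B" "p \<noteq> p'"
      by (cases x) auto
    then have "fst p \<noteq> fst p'" using block_rows by blast
    moreover have "p \<in> ?P" "p' \<in> ?P" using B block_cells by blast+
    ultimately show "x \<in> ?D" by (cases p; cases p') (simp add: x)
  qed
  have "card (B \<times> B - Id) = w * (w - 1)" if "B \<in> Bs" for B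
  proof -
    have "B \<times> B - Id = (B \<times> B) - (\<lambda>p. (p, p)) ` B" by auto
    moreover have "card ((\<lambda>p. (p, p)) ` B) = w"
      by (subst card_image) (auto simp: inj_on_def block_card that)
    ultimately have "card (B \<times> B - Id) = w * w - w"
      using finite_block[OF that] block_card[OF that]
      by (subst \<open>B \<times> B - Id = _\<close>, subst card_Diff_subset) (auto simp: card_cartesian_product)
    then show ?thesis by (simp add: diff_mult_distrib2)
  qed
  then have "card Bs * (w * (w - 1)) = (\<Sum>B\<in>Bs. card (B \<times> B - Id))" by simp
  also have "\<dots> = card ?D"
    unfolding D
  proof (rule card_UN_disjoint[symmetric])
    show "\<forall>A\<in>Bs. \<forall>B\<in>Bs. A \<noteq> B \<longrightarrow> (A \<times> A - Id) \<inter> (B \<times> B - Id) = {}"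
    proof (intro ballI impI equals0I)
      fix A B x
      assume "A \<in> Bs" "B \<in> Bs" "A \<noteq> B" and x: "x \<in> (A \<times> A - Id) \<inter> (B \<times> B - Id)"
      then show False using block_unique[of A B "fst x" "snd x"] by (cases x) auto
    qed
  qed (use finite_blocks finite_block in auto)
  also have "\<dots> = (\<Sum>p\<in>?P. card (({..<L} - {fst p}) \<times> {..<T}))" by (simp add: card_SigmaI)
  also have "\<dots> = (\<Sum>p\<in>?P. L * T - T)"
    by (intro sum.cong refl) (auto simp: card_cartesian_product card_Diff_singleton diff_mult_distrib)
  finally show ?thesis by (simp add: card_cartesian_product)
qed

text \<open>
  A shifted cell stays in its row, where the block has only one cell. Therefore even one cell that
  the shift does not move out of the block forces the shift to be the identity. This gives both the
  vanishing autocorrelation and the full length of the orbits.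
\<close>

lemma shift_fixes_block_imp_trivial:
  assumes B: "B \<in> Bs" and p: "p \<in> B" "row_shift T t p \<in> B" and t: "t < T"
  shows "t = 0"
proof -
  obtain i j where ij: "p = (i, j)" by (cases p)
  have "row_shift T t p = p" using block_rows[OF B p(2,1)] by (simp add: row_shift_def)
  then have "(j + t) mod T = j" by (simp add: ij)
  then have "T dvd t" by (metis add_diff_cancel_left' dvd_minus_mod)
  then show ?thesis using t by (meson dvd_imp_le leD neq0_conv)
qed

text \<open>
  The shifts act freely on the blocks, so a set of representatives of the orbits, shifted by all
  \<open>t < T\<close>, meets each block exactly once.
\<close>

lemma ex_orbit_representatives:
  obtains Rs where "Rs \<subseteq> Bs" "card Rs * T = card Bs"
    "\<And>A B t. \<lbrakk>A \<in> Rs; B \<in> Rs; row_shift T t ` A = B\<rbrakk> \<Longrightarrow> A = B"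
proof -
  define orbit where "orbit A = range (\<lambda>t. row_shift T t ` A)" for A
  define rep where "rep A = (SOME B. B \<in> orbit A)" for A
  have sub: "orbit (row_shift T t ` A) \<subseteq> orbit A" for A t
    by (auto simp: orbit_def row_shift_image_add)
  have orbit_eq: "orbit (row_shift T t ` A) = orbit A" if "A \<in> Bs" for A t
  proof
    \<comment> \<open>The inverse of the shift by \<open>t\<close>, with a nonnegative amount.\<close>
    have "row_shift T (T * t - t) ` row_shift T t ` A = row_shift T (T * t) ` A"
      using columns by (simp add: row_shift_image_add)
    then have "row_shift T (T * t - t) ` row_shift T t ` A = A"
      using row_shift_period block_cells[OF that] by metis
    then show "orbit A \<subseteq> orbit (row_shift T t ` A)" using sub by metis
  qed (rule sub)
  have rep_in: "rep A \<in> orbit A" for A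
    unfolding rep_def by (rule someI[of _ "row_shift T 0 ` A"]) (simp add: orbit_def)
  have rep_eq: "rep (row_shift T t ` A) = rep A" if "A \<in> Bs" for A t
    by (simp add: rep_def orbit_eq that)
  have rep_shift: "\<exists>t. rep A = row_shift T t ` A" for A
    using rep_in[of A] by (auto simp: orbit_def)
  have rep_Bs: "rep A \<in> Bs" if "A \<in> Bs" for A
    using rep_shift block_shift that by metis
  have rep_rep: "rep (rep A) = rep A" if "A \<in> Bs" for A
    using rep_shift rep_eq that by metis
  let ?Rs = "rep ` Bs"
  have separate: "A = B" if "A \<in> ?Rs" "B \<in> ?Rs" "row_shift T t ` A = B" for A B t
    using that rep_eq rep_rep rep_Bs by (metis imageE)
  have "bij_betw (\<lambda>(A, t). row_shift T t ` A) (?Rs \<times> {..<T}) Bs"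
  proof (rule bij_betw_imageI)
    show "inj_on (\<lambda>(A, t). row_shift T t ` A) (?Rs \<times> {..<T})"
    proof (rule inj_onI, clarify)
      fix A B t s
      assume A: "A \<in> Bs" and B: "B \<in> Bs" and t: "t < T" and s: "s < T"
        and eq: "row_shift T t ` rep A = row_shift T s ` rep B"
      have AB: "rep A = rep B"
        using arg_cong[OF eq, of rep] A B by (simp add: rep_eq rep_Bs rep_rep)
      obtain p where p: "p \<in> rep A"
        using block_card[OF rep_Bs[OF A]] weight by (cases "rep A = {}") auto
      let ?C = "row_shift T t ` rep A"
      have C: "?C \<in> Bs" using block_shift rep_Bs A by blast
      have "row_shift T t p = row_shift T s p"
        using C p eq AB by (intro block_rows[of ?C]) (auto simp: row_shift_def)
      then have "[snd p + t = snd p + s] (mod T)" by (simp add: row_shift_def cong_def)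
      then have "[t = s] (mod T)" by (simp only: cong_add_lcancel_nat)
      then have "t = s" using t s by (simp add: cong_def)
      then show "rep A = rep B \<and> t = s" using AB by simp
    qed
    have "B \<in> (\<lambda>(A, t). row_shift T t ` A) ` (?Rs \<times> {..<T})" if B: "B \<in> Bs" for B
    proof -
      obtain t where t: "rep B = row_shift T t ` B" using rep_shift by blast
      have "row_shift T ((T * t - t) mod T) ` rep B = row_shift T (T * t) ` B"
        using columns by (simp add: t row_shift_image_add row_shift_mod)
      also have "\<dots> = B" by (rule row_shift_period) (rule block_cells[OF B])
      finally show ?thesis
        using B columns by (intro image_eqI[of _ _ "(rep B, (T * t - t) mod T)"]) auto
    qed
    then show "(\<lambda>(A, t). row_shift T t ` A) ` (?Rs \<times> {..<T}) = Bs"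
      using rep_Bs block_shift by (intro equalityI) (auto simp del: row_shift_simp)
  qed
  from bij_betw_same_card[OF this] have "card ?Rs * T = card Bs"
    by (simp add: card_cartesian_product)
  then show thesis using that[of ?Rs] rep_Bs separate by blast
qed

text \<open>
  The code consists of the indicator arrays of orbit representatives. If each cell lies in \<open>r\<close>
  blocks, then \<open>r\<close> is the inner quotient of the Johnson bound, \<open>L * r div w\<close> is the outer one,
  and both divisions are exact.
\<close>

theorem ex_J_optimal_code:
  assumes dvd: "w - 1 dvd L * T - T"
  shows "\<exists>C. J_optimal_ideal_ooc_2d L T w 1 C"
proof -
  obtain Rs where Rs: "Rs \<subseteq> Bs" and count: "card Rs * T = card Bs"
    and separate: "\<And>A B t. \<lbrakk>A \<in> Rs; B \<in> Rs; row_shift T t ` A = B\<rbrakk> \<Longrightarrow> A = B"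
    using ex_orbit_representatives by blast
  let ?C = "indicator_array L T ` Rs"
  have cells: "A \<subseteq> {..<L} \<times> {..<T}" if "A \<in> Rs" for A
    using Rs block_cells that by blast
  have card_C: "card ?C = card Rs"
    using cells by (intro card_image inj_on_subset[OF inj_on_indicator_array]) blast

  obtain r where r: "L * T - T = (w - 1) * r" using dvd by blast
  have "card Rs * T * (w * (w - 1)) = L * T * ((w - 1) * r)"
    using block_count by (simp only: count r)
  then have Rs_w: "card Rs * w = L * r"
    using columns weight by (simp add: ac_simps)
  have "Bs \<noteq> {}"
    using block_ex[of "(0, 0)" "(1, 0)"] rows columns by auto
  then have "Rs \<noteq> {}" using count finite_blocks columns by auto

  have auto_corr: "correlation L T (indicator_array L T A) (indicator_array L T A) t \<le> 0"
    if A: "A \<in> Rs" and t: "t \<in> {1..<T}" for A t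
  proof -
    have "{p \<in> A. row_shift T t p \<in> A} = {}"
    proof (rule equals0I)
      fix p assume "p \<in> {p \<in> A. row_shift T t p \<in> A}"
      then show False using shift_fixes_block_imp_trivial[of A p t] A Rs t by auto
    qed
    then show ?thesis by (simp only: correlation_indicator_array[OF cells[OF A]]) simp
  qed
  have cross_corr: "correlation L T (indicator_array L T A) (indicator_array L T B) t \<le> 1"
    if A: "A \<in> Rs" and B: "B \<in> Rs" and "A \<noteq> B" for A B t
  proof -
    have ne: "row_shift T t ` A \<noteq> B" using separate that by blast
    have "p = p'" if "p \<in> {p \<in> A. row_shift T t p \<in> B}" "p' \<in> {p \<in> A. row_shift T t p \<in> B}" for p p'
    proof -
      have "row_shift T t p = row_shift T t p'"
        using block_unique[of "row_shift T t ` A" B "row_shift T t p" "row_shift T t p'"]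
        block_shift[of A t] A B Rs ne that by blast
      then show ?thesis
        using block_rows[of A p p'] A Rs that by (auto simp: row_shift_def)
    qed
    moreover have "finite {p \<in> A. row_shift T t p \<in> B}" using finite_block A Rs by auto
    ultimately have "card {p \<in> A. row_shift T t p \<in> B} \<le> 1"
      unfolding One_nat_def by (subst card_le_Suc0_iff_eq) blast+
    then show ?thesis by (simp only: correlation_indicator_array[OF cells[OF A]])
  qed
  have "ooc_2d L T w 0 1 ?C"
    unfolding ooc_2d_def
  proof (intro conjI ballI impI)
    show "?C \<noteq> {}" using \<open>Rs \<noteq> {}\<close> by simp
    show "?C \<subseteq> binary_arrays L T" using indicator_array_in_binary_arrays by blast
    show "array_weight L T A = w" if "A \<in> ?C" for A
      using that Rs array_weight_indicator_array[OF cells] block_card by auto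
    show "correlation L T A A t \<le> 0" if "A \<in> ?C" "t \<in> {1..<T}" for A t
      using that(1) auto_corr[OF _ that(2)] by (elim imageE) simp
    show "correlation L T A B t \<le> 1" if "A \<in> ?C" "B \<in> ?C" "A \<noteq> B" for A B t
      using that cross_corr by blast
  qed
  moreover have "int (card ?C) = johnson_bound_ideal L T w 1"
  proof -
    have "T \<le> L * T" using rows by simp
    then have "real (L * T) - real T = (real w - 1) * real r"
      using arg_cong[OF r, of real] weight by (simp add: of_nat_diff)
    then have "(real (L * T) - real T) / (real w - 1) = real r" using weight by simp
    moreover have "real (L * T) / (real T * real w) * real r = real (card Rs)"
      using arg_cong[OF Rs_w, of real] columns weight by (simp add: field_simps)
    ultimately show ?thesis
      unfolding johnson_bound_ideal_1 card_C by simp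
  qed
  ultimately show ?thesis unfolding J_optimal_ideal_ooc_2d_def by blast
qed

end

section \<open>The Frobenius map and finite fields\<close>

lemma (in cring) binomial_expansion:
  assumes [simp]: "x \<in> carrier R" "y \<in> carrier R"
  shows "(x \<oplus> y) [^] (n::nat) = (\<Oplus>k\<in>{..n}. [(n choose k)] \<cdot> (x [^] k \<otimes> y [^] (n - k)))"
proof (induction n)
  case 0
  then show ?case by simp
next
  case (Suc n)
  define f where "f k = [(n choose k)] \<cdot> (x [^] k \<otimes> y [^] (n - k))" for k
  define g where "g k = [(n choose k)] \<cdot> (x [^] k \<otimes> y [^] (Suc n - k))" for k
  define h where "h k = (if k = 0 then \<zero> else [(n choose (k - 1))] \<cdot> (x [^] k \<otimes> y [^] (Suc n - k)))" for k
  have [simp]: "f k \<in> carrier R" "g k \<in> carrier R" "h k \<in> carrier R" for k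
    by (auto simp: f_def g_def h_def)
  have fx: "f k \<otimes> x = h (Suc k)" for k
  proof -
    have "x [^] k \<otimes> y [^] (n - k) \<otimes> x = x [^] Suc k \<otimes> y [^] (n - k)"
      by (simp add: m_ac)
    then show ?thesis by (simp add: f_def h_def add_pow_ldistr)
  qed
  have fy: "f k \<otimes> y = g k" if "k \<le> n" for k
    using that by (simp add: f_def g_def add_pow_ldistr m_assoc Suc_diff_le)
  have "(x \<oplus> y) [^] Suc n = (\<Oplus>k\<in>{..n}. f k) \<otimes> x \<oplus> (\<Oplus>k\<in>{..n}. f k) \<otimes> y"
    by (simp add: Suc.IH r_distr flip: f_def)
  also have "(\<Oplus>k\<in>{..n}. f k) \<otimes> x = (\<Oplus>k\<in>{..n}. h (Suc k))"
    by (simp add: finsum_ldistr fx)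
  also have "\<dots> = (\<Oplus>k\<in>{..Suc n}. h k)"
    by (subst add.finprod_Suc2) (auto simp: h_def[of 0])
  also have "(\<Oplus>k\<in>{..n}. f k) \<otimes> y = (\<Oplus>k\<in>{..n}. g k)"
    by (auto simp: finsum_ldistr fy intro!: add.finprod_cong)
  also have "\<dots> = (\<Oplus>k\<in>{..Suc n}. g k)"
    by (subst add.finprod_Suc) (auto simp: g_def[of "Suc n"] binomial_eq_0)
  also have "(\<Oplus>k\<in>{..Suc n}. h k) \<oplus> (\<Oplus>k\<in>{..Suc n}. g k) = (\<Oplus>k\<in>{..Suc n}. h k \<oplus> g k)"
    by (subst add.finprod_multf) auto
  also have "\<dots> = (\<Oplus>k\<in>{..Suc n}. [(Suc n choose k)] \<cdot> (x [^] k \<otimes> y [^] (Suc n - k)))"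
  proof (intro add.finprod_cong' refl)
    fix k assume "k \<in> {..Suc n}"
    show "h k \<oplus> g k = [(Suc n choose k)] \<cdot> (x [^] k \<otimes> y [^] (Suc n - k))"
      by (cases k) (simp_all add: h_def g_def add.nat_pow_mult add_ac del: nat_pow_Suc Group.nat_pow_Suc)
  qed auto
  finally show ?case .
qed

text \<open>
  In characteristic \<open>p\<close> all inner binomial coefficients of a \<open>p\<close>-th power vanish; the statement
  follows by iteration.
\<close>

lemma (in cring) frobenius_add:
  assumes p: "Factorial_Ring.prime (p::nat)" and char: "[p] \<cdot> \<one> = \<zero>"
    and [simp]: "x \<in> carrier R" "y \<in> carrier R"
  shows "(x \<oplus> y) [^] (p ^ m) = x [^] (p ^ m) \<oplus> y [^] (p ^ m)"
proof (induction m)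
  case 0
  then show ?case by simp
next
  case (Suc m)
  have frob: "(a \<oplus> b) [^] p = a [^] p \<oplus> b [^] p" if [simp]: "a \<in> carrier R" "b \<in> carrier R" for a b
  proof -
    have p0: "p > 0" using p by (rule prime_gt_0_nat)
    have mid: "[(p choose k)] \<cdot> z = \<zero>" if "0 < k" "k < p" and [simp]: "z \<in> carrier R" for k z
    proof -
      have "p dvd p choose k" using that p by (intro dvd_choose_prime) auto
      then obtain r where r: "p choose k = p * r" by blast
      have "[p] \<cdot> z = ([p] \<cdot> \<one>) \<otimes> z" by (simp add: add_pow_ldistr)
      then have "[p] \<cdot> z = \<zero>" by (simp add: char)
      then show ?thesis by (simp add: r flip: add.nat_pow_pow)
    qed
    have "(a \<oplus> b) [^] p = (\<Oplus>k\<in>{..p}. [(p choose k)] \<cdot> (a [^] k \<otimes> b [^] (p - k)))"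
      by (rule binomial_expansion) simp_all
    also have "\<dots> = (\<Oplus>k\<in>{0, p}. [(p choose k)] \<cdot> (a [^] k \<otimes> b [^] (p - k)))"
      by (rule add.finprod_mono_neutral_cong_right) (auto intro!: mid)
    also have "\<dots> = a [^] p \<oplus> b [^] p"
      using p0 by (simp add: a_comm)
    finally show ?thesis .
  qed
  have "(x \<oplus> y) [^] (p ^ Suc m) = ((x \<oplus> y) [^] (p ^ m)) [^] p"
    by (simp add: nat_pow_pow mult.commute)
  also have "\<dots> = (x [^] (p ^ m)) [^] p \<oplus> (y [^] (p ^ m)) [^] p"
    by (simp add: Suc.IH frob)
  finally show ?case by (simp add: nat_pow_pow mult.commute)
qed

lemma (in cring) frobenius_minus:
  assumes p: "Factorial_Ring.prime (p::nat)" and char: "[p] \<cdot> \<one> = \<zero>"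
    and [simp]: "x \<in> carrier R"
  shows "(\<ominus> x) [^] (p ^ m) = \<ominus> (x [^] (p ^ m))"
proof -
  have "p ^ m \<noteq> 0" using p by auto
  then have "\<zero> [^] (p ^ m) = \<zero>" by (rule nat_pow_zero)
  then have "(\<ominus> x) [^] (p ^ m) \<oplus> x [^] (p ^ m) = \<zero>"
    using frobenius_add[OF p char, of "\<ominus> x" x m] by (simp add: l_neg)
  then show ?thesis by (simp add: minus_equality)
qed

definition (in cring) frobenius_fixed :: "nat \<Rightarrow> 'a set" where
  "frobenius_fixed q = {x \<in> carrier R. x [^] q = x}"

lemma (in field) subfield_frobenius_fixed:
  assumes p: "Factorial_Ring.prime (p::nat)" and char: "[p] \<cdot> \<one> = \<zero>"
  shows "subfield (frobenius_fixed (p ^ m)) R"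
proof (rule subfieldI')
  show "subring (frobenius_fixed (p ^ m)) R"
    by (rule subringI)
      (auto simp: frobenius_fixed_def frobenius_add[OF p char] frobenius_minus[OF p char] nat_pow_distrib)
next
  fix x assume "x \<in> frobenius_fixed (p ^ m) - {\<zero>}"
  then have x: "x \<in> carrier R" "x [^] (p ^ m) = x" "x \<in> Units R"
    by (auto simp: frobenius_fixed_def field_Units)
  have "inv x [^] (p ^ m) \<otimes> x [^] (p ^ m) = (inv x \<otimes> x) [^] (p ^ m)"
    using x by (intro nat_pow_distrib[symmetric]) auto
  then have "inv x [^] (p ^ m) \<otimes> x = \<one>" using x by simp
  then have "inv x [^] (p ^ m) = inv x" using x by (metis Units_inv_closed inv_char m_comm nat_pow_closed)
  then show "inv x \<in> frobenius_fixed (p ^ m)" using x by (simp add: frobenius_fixed_def)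
qed

lemma (in ring_hom_ring) hom_add_pow:
  assumes "x \<in> carrier R"
  shows "h ([(n::nat)] \<cdot>\<^bsub>R\<^esub> x) = [n] \<cdot>\<^bsub>S\<^esub> h x"
  using assms by (induction n) auto

text \<open>
  The fixed points are the roots of \<open>X ^ Q - X\<close> with \<open>Q = p ^ m\<close>. Their number with multiplicity is
  \<open>Q\<close>, since the polynomial splits. For a root \<open>a\<close>, additivity of the Frobenius map on polynomials
  gives \<open>X ^ Q - X = (X - a) ^ Q - (X - a)\<close>, so \<open>(X - a)\<^sup>2\<close> does not divide it and all roots are simple.
\<close>

lemma (in algebraically_closed) card_frobenius_fixed:
  assumes p: "Factorial_Ring.prime (p::nat)" and char: "[p] \<cdot> \<one> = \<zero>" and m: "m > 0"
  shows "card (frobenius_fixed (p ^ m)) = p ^ m"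
proof -
  let ?P = "poly_ring L"
  let ?Q = "p ^ m"
  interpret UP: domain ?P using univ_poly_is_domain[OF carrier_is_subring] .
  define f where "f = X [^]\<^bsub>?P\<^esub> ?Q \<ominus>\<^bsub>?P\<^esub> X"
  have X [simp]: "X \<in> carrier ?P" using var_closed[OF carrier_is_subring] by simp
  have Q: "?Q > 1" using p m by (metis one_less_power prime_gt_1_nat)
  have f [simp]: "f \<in> carrier ?P" by (simp add: f_def)
  have deg_pow: "degree (X [^]\<^bsub>?P\<^esub> ?Q) = ?Q"
    using polynomial_pow_degree[OF X, of ?Q] by (simp add: var_def)
  have deg: "degree f = ?Q"
  proof -
    have "degree (\<ominus>\<^bsub>?P\<^esub> X) = 1"
      using univ_poly_a_inv_degree[OF carrier_is_subring X] by (simp add: var_def)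
    then have "degree (poly_add (X [^]\<^bsub>?P\<^esub> ?Q) (\<ominus>\<^bsub>?P\<^esub> X)) = max ?Q 1"
      using poly_add_degree_eq[OF carrier_is_subring, of "X [^]\<^bsub>?P\<^esub> ?Q" "\<ominus>\<^bsub>?P\<^esub> X"] Q deg_pow
      unfolding univ_poly_carrier by (metis UP.add.inv_closed UP.nat_pow_closed X less_irrefl)
    then show ?thesis
      using Q unfolding f_def a_minus_def univ_poly_add by linarith
  qed
  have f0: "f \<noteq> []"
  proof
    assume "f = []"
    then have "degree f = 0" by simp
    then show False using deg Q by linarith
  qed
  have eval_f: "eval f a = a [^] ?Q \<ominus> a" if a: "a \<in> carrier L" for a
  proof -
    interpret E: ring_hom_ring ?P L "\<lambda>p. eval p a"
      using eval_ring_hom[OF carrier_is_subring a] .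
    show ?thesis
      by (simp add: f_def a_minus_def E.hom_nat_pow eval_var a)
  qed
  have root_iff: "a \<in># roots f \<longleftrightarrow> a \<in> frobenius_fixed ?Q" for a
    using f0 by (auto simp: roots_mem_iff_is_root is_root_def eval_f frobenius_fixed_def)
  interpret C: ring_hom_ring L ?P poly_of_const
    using canonical_embedding_ring_hom[OF carrier_is_subring] by simp
  have charP: "[p] \<cdot>\<^bsub>?P\<^esub> \<one>\<^bsub>?P\<^esub> = \<zero>\<^bsub>?P\<^esub>"
    using C.hom_add_pow[of \<one> p] by (simp add: char)
  have simple: "alg_mult f a \<le> 1" if "a \<in> frobenius_fixed ?Q" for a
  proof (rule ccontr)
    assume "\<not> alg_mult f a \<le> 1"
    then have two: "2 \<le> alg_mult f a" by simp
    have a: "a \<in> carrier L" "a [^] ?Q = a" using that by (auto simp: frobenius_fixed_def)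
    let ?l = "[\<one>, \<ominus> a]"
    have l_eq: "?l = X \<ominus>\<^bsub>?P\<^esub> poly_of_const a"
    proof -
      have "?l = X \<oplus>\<^bsub>?P\<^esub> poly_of_const (\<ominus> a)"
        using a by (simp add: univ_poly_add var_def poly_of_const_def)
      then show ?thesis using a by (simp add: a_minus_def)
    qed
    have l [simp]: "?l \<in> carrier ?P" using a by (simp add: l_eq)
    have "poly_of_const a [^]\<^bsub>?P\<^esub> ?Q = poly_of_const a"
      using C.hom_nat_pow[of a ?Q] a by simp
    then have "?l [^]\<^bsub>?P\<^esub> ?Q = X [^]\<^bsub>?P\<^esub> ?Q \<ominus>\<^bsub>?P\<^esub> poly_of_const a"
      using UP.frobenius_add[OF p charP, of X "\<ominus>\<^bsub>?P\<^esub> poly_of_const a" m]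
        UP.frobenius_minus[OF p charP, of "poly_of_const a" m] a
      by (simp add: l_eq a_minus_def)
    then have l_f: "?l [^]\<^bsub>?P\<^esub> ?Q = f \<oplus>\<^bsub>?P\<^esub> ?l"
      using a by (simp add: f_def l_eq a_minus_def UP.a_ac UP.r_neg1 UP.r_neg2)
    obtain g where g: "g \<in> carrier ?P" "f = ?l [^]\<^bsub>?P\<^esub> (2::nat) \<otimes>\<^bsub>?P\<^esub> g"
      using le_alg_mult_imp_pdivides[OF a(1) f two] by (auto simp: pdivides_def factor_def)
    obtain r where r: "?Q = 2 + r" using Q by (metis Suc_1 Suc_leI le_Suc_ex)
    let ?s = "?l [^]\<^bsub>?P\<^esub> (2::nat)"
    \<comment> \<open>If the square of \<open>X - a\<close> divided \<open>f\<close>, then it would divide \<open>X - a\<close> itself.\<close>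
    have "?l = (f \<oplus>\<^bsub>?P\<^esub> ?l) \<ominus>\<^bsub>?P\<^esub> f"
      using f l by (simp add: a_minus_def UP.a_ac UP.r_neg1 UP.r_neg2)
    also have "f \<oplus>\<^bsub>?P\<^esub> ?l = ?s \<otimes>\<^bsub>?P\<^esub> ?l [^]\<^bsub>?P\<^esub> r"
      unfolding l_f[symmetric] by (simp only: r UP.nat_pow_mult[OF l])
    also have "\<dots> \<ominus>\<^bsub>?P\<^esub> f = ?s \<otimes>\<^bsub>?P\<^esub> ?l [^]\<^bsub>?P\<^esub> r \<ominus>\<^bsub>?P\<^esub> ?s \<otimes>\<^bsub>?P\<^esub> g"
      by (simp only: g(2)[symmetric])
    also have "\<dots> = ?s \<otimes>\<^bsub>?P\<^esub> (?l [^]\<^bsub>?P\<^esub> r \<ominus>\<^bsub>?P\<^esub> g)"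
      using l g(1) by (simp add: a_minus_def UP.r_distr UP.r_minus)
    finally have "?s pdivides ?l"
      unfolding pdivides_def factor_def using l g(1) by blast
    then have "degree ?s \<le> degree ?l"
      using pdivides_imp_degree_le[OF carrier_is_subring, of ?s ?l] l by simp
    then show False using polynomial_pow_degree[OF l, of 2] by simp
  qed
  have "frobenius_fixed ?Q = set_mset (roots f)" using root_iff by blast
  then have fin: "finite (frobenius_fixed ?Q)" by simp
  have "size (roots f) = ?Q"
    using roots_over_carrier[OF f] deg by (simp add: splitted_def)
  moreover have "roots f = mset_set (frobenius_fixed ?Q)"
  proof (rule multiset_eqI)
    fix a
    show "count (roots f) a = count (mset_set (frobenius_fixed ?Q)) a"
      using root_iff[of a] simple[of a] fin alg_mult_eq_count_roots[OF f]
      by (cases "a \<in> frobenius_fixed ?Q") (auto simp: not_in_iff le_Suc_eq simp flip: count_greater_zero_iff)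
  qed
  ultimately show ?thesis by (simp add: size_mset_set)
qed


lemma (in cring) frobenius_fixed_mono:
  assumes "m dvd n"
  shows "frobenius_fixed (p ^ m) \<subseteq> frobenius_fixed (p ^ n)"
proof -
  obtain c where c: "n = m * c" using assms by blast
  have "x [^] (p ^ (m * c)) = x" if x: "x \<in> carrier R" "x [^] (p ^ m) = x" for x
  proof (induction c)
    case (Suc c)
    have "x [^] (p ^ (m * Suc c)) = (x [^] (p ^ (m * c))) [^] (p ^ m)"
      using x by (simp add: nat_pow_pow power_add mult.commute)
    then show ?case using Suc x by simp
  qed (use x in simp)
  then show ?thesis by (auto simp: frobenius_fixed_def c)
qed

text \<open>
  The field is the fixed field of the \<open>n\<close>-th power of the Frobenius map in an algebraic closure of the
  integers modulo \<open>p\<close>; the element type is that of the closure. For \<open>m\<close> dividing \<open>n\<close>, the fixed field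
  of the \<open>m\<close>-th power in the closure is already contained in it, which yields the sizes of the
  subfields.
\<close>

theorem ex_finite_field:
  assumes p: "Factorial_Ring.prime (p::nat)" and n: "n > 0"
  shows "\<exists>R :: ((int list \<times> nat) multiset \<Rightarrow> int) ring.
    field R \<and> card (carrier R) = p ^ n \<and> [p] \<cdot>\<^bsub>R\<^esub> \<one>\<^bsub>R\<^esub> = \<zero>\<^bsub>R\<^esub> \<and>
    (\<forall>m>0. m dvd n \<longrightarrow> card (cring.frobenius_fixed R (p ^ m)) = p ^ m)"
proof -
  interpret Z: residues_prime p "residue_ring (int p)" by unfold_locales (fact p)
  interpret Z: field "residue_ring (int p)" by (rule Z.is_field)
  obtain L :: "((int list \<times> nat) multiset \<Rightarrow> int) ring"
    where L: "algebraic_closure L (Z.indexed_const ` carrier (residue_ring (int p)))"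
      and hom: "Z.indexed_const \<in> ring_hom (residue_ring (int p)) L"
    by (rule Z.exists_closure)
  interpret L: algebraic_closure L "Z.indexed_const ` carrier (residue_ring (int p))" by (rule L)
  interpret h: ring_hom_ring "residue_ring (int p)" L Z.indexed_const
    by (rule ring_hom_ringI2[OF Z.is_ring L.is_ring hom])
  have "[m] \<cdot>\<^bsub>residue_ring (int p)\<^esub> \<one>\<^bsub>residue_ring (int p)\<^esub> = int m mod int p" for m :: nat
    by (induction m) (simp_all add: Z.res_zero_eq Z.res_add_eq Z.res_one_eq mod_simps add.commute)
  then have "[p] \<cdot>\<^bsub>residue_ring (int p)\<^esub> \<one>\<^bsub>residue_ring (int p)\<^esub> = \<zero>\<^bsub>residue_ring (int p)\<^esub>"
    by (simp add: Z.res_zero_eq)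
  then have char: "[p] \<cdot>\<^bsub>L\<^esub> \<one>\<^bsub>L\<^esub> = \<zero>\<^bsub>L\<^esub>"
    using h.hom_add_pow[OF Z.one_closed, of p] by simp
  let ?R = "L\<lparr>carrier := L.frobenius_fixed (p ^ n)\<rparr>"
  have field: "field ?R"
    using L.subfield_frobenius_fixed[OF p char] by (rule L.subfield_iff(2))
  moreover have "card (carrier ?R) = p ^ n"
    using L.card_frobenius_fixed[OF p char n] by simp
  moreover have "[p] \<cdot>\<^bsub>?R\<^esub> \<one>\<^bsub>?R\<^esub> = \<zero>\<^bsub>?R\<^esub>"
    using char by (simp add: add_pow_def nat_pow_def)
  moreover have "card (cring.frobenius_fixed ?R (p ^ m)) = p ^ m" if "m > 0" "m dvd n" for m
  proof -
    have "cring.frobenius_fixed ?R (p ^ m) = L.frobenius_fixed (p ^ n) \<inter> L.frobenius_fixed (p ^ m)"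
      unfolding cring.frobenius_fixed_def[OF fieldE(1)[OF field]]
      by (auto simp: L.frobenius_fixed_def nat_pow_def)
    also have "\<dots> = L.frobenius_fixed (p ^ m)"
      using L.frobenius_fixed_mono[OF that(2)] by blast
    finally show ?thesis using L.card_frobenius_fixed[OF p char that(1)] by simp
  qed
  ultimately show ?thesis by blast
qed

lemma (in field) ex_primitive_element:
  assumes fin: "finite (carrier R)"
  obtains \<alpha> where "\<alpha> \<in> carrier R" "\<alpha> \<noteq> \<zero>"
    "\<And>x. \<lbrakk>x \<in> carrier R; x \<noteq> \<zero>\<rbrakk> \<Longrightarrow> \<exists>n::nat. x = \<alpha> [^] n"
    "\<And>a b::nat. \<alpha> [^] a = \<alpha> [^] b \<longleftrightarrow> [a = b] (mod card (carrier R) - 1)"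
proof -
  interpret G: group "Multiplicative_Group.mult_of R" by (rule field_mult_group)
  obtain \<alpha> where \<alpha>: "\<alpha> \<in> carrier (Multiplicative_Group.mult_of R)"
    and gen: "carrier (Multiplicative_Group.mult_of R) = {\<alpha> [^] i | i::nat. i \<in> UNIV}"
    using finite_field_mult_group_has_gen[OF fin] by blast
  have fin': "finite (carrier (Multiplicative_Group.mult_of R))" using fin by simp
  have "carrier (Multiplicative_Group.mult_of R) = generate (Multiplicative_Group.mult_of R) {\<alpha>}"
    using G.generate_pow_on_finite_carrier[OF fin' \<alpha>] gen by (simp add: Multiplicative_Group.nat_pow_mult_of)
  then have "G.ord \<alpha> = card (carrier (Multiplicative_Group.mult_of R))"
    using G.generate_pow_card[OF \<alpha>] by simp
  then have ord: "G.ord \<alpha> = card (carrier R) - 1"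
    using fin by (simp add: card_Diff_singleton)
  have "\<alpha> [^] a = \<alpha> [^] b \<longleftrightarrow> [a = b] (mod card (carrier R) - 1)" for a b :: nat
  proof -
    have "\<alpha> [^] a = \<alpha> [^] b \<longleftrightarrow> \<alpha> [^]\<^bsub>Multiplicative_Group.mult_of R\<^esub> int a = \<alpha> [^]\<^bsub>Multiplicative_Group.mult_of R\<^esub> int b"
      by (simp add: Multiplicative_Group.nat_pow_mult_of int_pow_int)
    also have "\<dots> \<longleftrightarrow> [int b = int a] (mod int (card (carrier R) - 1))"
      by (simp only: G.int_pow_eq[OF \<alpha>] ord cong_iff_dvd_diff)
    finally show ?thesis by (simp only: cong_int_iff cong_sym_eq)
  qed
  moreover have "\<exists>n::nat. x = \<alpha> [^] n" if "x \<in> carrier R" "x \<noteq> \<zero>" for x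
    using gen that by auto
  ultimately show thesis using that[of \<alpha>] \<alpha> by auto
qed

text \<open>
  The nonzero elements fixed by the power \<open>s + 1\<close> are the \<open>s\<close>-th roots of unity, so a ratio is
  fixed exactly if the \<open>s\<close>-th powers agree.
\<close>

lemma (in field) proportional_over_frobenius_fixed:
  assumes x: "x \<in> carrier R" "x \<noteq> \<zero>" and y: "y \<in> carrier R" "y \<noteq> \<zero>"
  shows "(\<exists>c\<in>frobenius_fixed (Suc s). x = c \<otimes> y) \<longleftrightarrow> x [^] s = y [^] s"
proof
  assume "\<exists>c\<in>frobenius_fixed (Suc s). x = c \<otimes> y"
  then obtain c where c: "c \<in> carrier R" "c [^] s \<otimes> c = c" and xc: "x = c \<otimes> y"
    by (auto simp: frobenius_fixed_def)
  have "c \<noteq> \<zero>" using x xc y by auto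
  then have "c [^] s = \<one>" using c m_rcancel[of c "c [^] s" \<one>] by simp
  then show "x [^] s = y [^] s" using c y by (simp add: xc nat_pow_distrib)
next
  assume eq: "x [^] s = y [^] s"
  have yU: "y \<in> Units R" using y by (simp add: field_Units)
  let ?c = "x \<otimes> inv y"
  have c: "?c \<in> carrier R" using x yU by simp
  have xc: "x = ?c \<otimes> y" using x y yU by (simp add: m_assoc)
  have "y [^] s \<noteq> \<zero>" using y by (induction s) (auto simp: integral_iff)
  moreover have "?c [^] s \<otimes> y [^] s = y [^] s"
    using c y by (subst nat_pow_distrib[symmetric]) (simp_all flip: xc add: eq)
  ultimately have "?c [^] s = \<one>" using c y m_rcancel[of "y [^] s" "?c [^] s" \<one>] by simp
  then have "?c \<in> frobenius_fixed (Suc s)" using c by (simp add: frobenius_fixed_def)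
  then show "\<exists>c\<in>frobenius_fixed (Suc s). x = c \<otimes> y" using xc by blast
qed

text \<open>
  Translates proportionality over a fixed field with \<open>s + 1\<close> elements into a congruence of discrete
  logarithms. The modulus \<open>g\<close> is the number of classes of proportional elements: the number of points
  for the small subfield, and the number of rows for the large one.
\<close>

lemma (in field) proportional_powers_over_frobenius_fixed:
  assumes \<alpha>: "\<alpha> \<in> carrier R" "\<alpha> \<noteq> \<zero>"
    and prim: "\<And>a b::nat. \<alpha> [^] a = \<alpha> [^] b \<longleftrightarrow> [a = b] (mod g * s)" and s: "s > 0"
  shows "(\<exists>c\<in>frobenius_fixed (Suc s). \<alpha> [^] (a::nat) = c \<otimes> \<alpha> [^] (b::nat)) \<longleftrightarrow> [a = b] (mod g)"
proof -
  have nz: "\<alpha> [^] (n::nat) \<noteq> \<zero>" for n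
    using \<alpha> by (induction n) (auto simp: integral_iff)
  have "(\<exists>c\<in>frobenius_fixed (Suc s). \<alpha> [^] a = c \<otimes> \<alpha> [^] b) \<longleftrightarrow> [a * s = b * s] (mod g * s)"
    using proportional_over_frobenius_fixed[of "\<alpha> [^] a" "\<alpha> [^] b" s] \<alpha> nz
    by (simp add: nat_pow_pow prim)
  also have "\<dots> \<longleftrightarrow> [a = b] (mod g)" using s by (simp add: cong_def mod_mult_mult2)
  finally show ?thesis .
qed


section \<open>Planes over a subfield\<close>

context field begin

definition plane :: "'a set \<Rightarrow> 'a \<Rightarrow> 'a \<Rightarrow> 'a set" where
  "plane K x y = (\<lambda>(a, b). a \<otimes> x \<oplus> b \<otimes> y) ` (K \<times> K)"

text \<open>
  Linear independence as injectivity of the coordinate map. Over a finite subfield it thereby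
  becomes the statement that the plane has the largest possible size, and the exchange arguments
  below reduce to comparing cardinalities.
\<close>

definition indep2 :: "'a set \<Rightarrow> 'a \<Rightarrow> 'a \<Rightarrow> bool" where
  "indep2 K x y \<longleftrightarrow> inj_on (\<lambda>(a, b). a \<otimes> x \<oplus> b \<otimes> y) (K \<times> K)"

lemma card_plane_le: "finite K \<Longrightarrow> card (plane K x y) \<le> card K * card K"
  unfolding plane_def by (rule order_trans[OF card_image_le]) (simp_all add: card_cartesian_product)

lemma indep2_iff_card:
  "finite K \<Longrightarrow> indep2 K x y \<longleftrightarrow> card (plane K x y) = card K * card K"
  unfolding plane_def indep2_def
  using inj_on_iff_eq_card[of "K \<times> K" "\<lambda>(a, b). a \<otimes> x \<oplus> b \<otimes> y"] by (simp add: card_cartesian_product)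

lemma planeE:
  assumes "z \<in> plane K x y"
  obtains a b where "a \<in> K" "b \<in> K" "z = a \<otimes> x \<oplus> b \<otimes> y"
  using assms by (auto simp: plane_def)

lemma planeI: "a \<in> K \<Longrightarrow> b \<in> K \<Longrightarrow> z = a \<otimes> x \<oplus> b \<otimes> y \<Longrightarrow> z \<in> plane K x y"
  by (force simp: plane_def)

context
  fixes K assumes K: "subfield K R"
begin

lemma subfield_closed:
  "\<zero> \<in> K" "\<one> \<in> K" "a \<in> K \<Longrightarrow> a \<in> carrier R"
  "\<lbrakk>a \<in> K; b \<in> K\<rbrakk> \<Longrightarrow> a \<otimes> b \<in> K" "\<lbrakk>a \<in> K; b \<in> K\<rbrakk> \<Longrightarrow> a \<oplus> b \<in> K" "a \<in> K \<Longrightarrow> \<ominus> a \<in> K"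
  "a \<in> K \<Longrightarrow> a \<noteq> \<zero> \<Longrightarrow> inv a \<in> K"
  using subringE[OF subfieldE(1)[OF K]] subfield_m_inv(1)[OF K] by auto

lemma plane_carrier: "x \<in> carrier R \<Longrightarrow> y \<in> carrier R \<Longrightarrow> plane K x y \<subseteq> carrier R"
  by (auto simp: plane_def subfield_closed)

lemma plane_add:
  assumes "x \<in> carrier R" "y \<in> carrier R" "z \<in> plane K x y" "w \<in> plane K x y"
  shows "z \<oplus> w \<in> plane K x y"
proof -
  obtain a b c d where abcd: "a \<in> K" "b \<in> K" "c \<in> K" "d \<in> K"
    and zw: "z = a \<otimes> x \<oplus> b \<otimes> y" "w = c \<otimes> x \<oplus> d \<otimes> y"
    using assms(3,4) by (metis planeE)
  note [simp] = abcd[THEN subfield_closed(3)] assms(1,2)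
  have "z \<oplus> w = (a \<oplus> c) \<otimes> x \<oplus> (b \<oplus> d) \<otimes> y"
    by (simp add: zw l_distr a_ac)
  then show ?thesis using abcd by (intro planeI[of "a \<oplus> c" K "b \<oplus> d"]) (simp_all add: subfield_closed)
qed

lemma plane_smult:
  assumes "x \<in> carrier R" "y \<in> carrier R" "z \<in> plane K x y" "c \<in> K"
  shows "c \<otimes> z \<in> plane K x y"
proof -
  obtain a b where ab: "a \<in> K" "b \<in> K" and z: "z = a \<otimes> x \<oplus> b \<otimes> y"
    using assms(3) by (rule planeE)
  note [simp] = ab[THEN subfield_closed(3)] assms(1,2) assms(4)[THEN subfield_closed(3)]
  have "c \<otimes> z = (c \<otimes> a) \<otimes> x \<oplus> (c \<otimes> b) \<otimes> y"
    by (simp add: z r_distr m_assoc)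
  then show ?thesis using ab assms(4) by (intro planeI[of "c \<otimes> a" K "c \<otimes> b"]) (simp_all add: subfield_closed)
qed

lemma plane_subset_plane:
  assumes "x \<in> carrier R" "y \<in> carrier R" "z \<in> plane K x y" "w \<in> plane K x y"
  shows "plane K z w \<subseteq> plane K x y"
  using assms by (auto simp: plane_def[of K z w] intro!: plane_add plane_smult)

lemma generators_in_plane:
  assumes "x \<in> carrier R" "y \<in> carrier R"
  shows "x \<in> plane K x y" "y \<in> plane K x y"
  using assms by (auto intro: planeI[of \<one> K \<zero>] planeI[of \<zero> K \<one>] simp: subfield_closed)

lemma plane_translate:
  assumes "x \<in> carrier R" "y \<in> carrier R" "u \<in> carrier R" "z \<in> plane K x y"
  shows "u \<otimes> z \<in> plane K (u \<otimes> x) (u \<otimes> y)"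
proof -
  obtain a b where ab: "a \<in> K" "b \<in> K" and z: "z = a \<otimes> x \<oplus> b \<otimes> y"
    using assms(4) by (rule planeE)
  note [simp] = ab[THEN subfield_closed(3)] assms(1-3)
  have "u \<otimes> z = a \<otimes> (u \<otimes> x) \<oplus> b \<otimes> (u \<otimes> y)"
    by (simp add: z r_distr m_lcomm)
  then show ?thesis using ab by (intro planeI)
qed

lemma indep2_iff_not_proportional:
  assumes [simp]: "x \<in> carrier R" "y \<in> carrier R" and nz: "x \<noteq> \<zero>" "y \<noteq> \<zero>"
  shows "indep2 K x y \<longleftrightarrow> \<not> (\<exists>c\<in>K. x = c \<otimes> y)"
proof
  assume ind: "indep2 K x y"
  show "\<not> (\<exists>c\<in>K. x = c \<otimes> y)"
  proof
    assume "\<exists>c\<in>K. x = c \<otimes> y"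
    then obtain c where c: "c \<in> K" "x = c \<otimes> y" by blast
    then have "\<one> \<otimes> x \<oplus> \<zero> \<otimes> y = \<zero> \<otimes> x \<oplus> c \<otimes> y"
      by (simp add: subfield_closed)
    then have "\<one> = \<zero>"
      using inj_onD[OF ind[unfolded indep2_def], of "(\<one>, \<zero>)" "(\<zero>, c)"] c by (simp add: subfield_closed)
    then show False by simp
  qed
next
  assume not: "\<not> (\<exists>c\<in>K. x = c \<otimes> y)"
  show "indep2 K x y"
    unfolding indep2_def
  proof (rule inj_onI, clarify)
    fix a b a' b'
    assume K4: "a \<in> K" "b \<in> K" "a' \<in> K" "b' \<in> K" and eq: "a \<otimes> x \<oplus> b \<otimes> y = a' \<otimes> x \<oplus> b' \<otimes> y"
    note [simp] = K4[THEN subfield_closed(3)]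
    have "(a \<ominus> a') \<otimes> x = (a \<otimes> x \<oplus> b \<otimes> y) \<ominus> (a' \<otimes> x \<oplus> b \<otimes> y)"
      using assms(1,2) K4[THEN subfield_closed(3)] by algebra
    also have "\<dots> = (b' \<ominus> b) \<otimes> y"
      unfolding eq using assms(1,2) K4[THEN subfield_closed(3)] by algebra
    finally have e: "(a \<ominus> a') \<otimes> x = (b' \<ominus> b) \<otimes> y" .
    have "a \<ominus> a' = \<zero>"
    proof (rule ccontr)
      assume n: "a \<ominus> a' \<noteq> \<zero>"
      then have u: "a \<ominus> a' \<in> Units R" by (simp add: field_Units)
      have "x = inv (a \<ominus> a') \<otimes> ((a \<ominus> a') \<otimes> x)" using u by (simp add: m_assoc[symmetric])
      also have "\<dots> = (inv (a \<ominus> a') \<otimes> (b' \<ominus> b)) \<otimes> y" using u by (simp add: e m_assoc)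
      finally have "x = (inv (a \<ominus> a') \<otimes> (b' \<ominus> b)) \<otimes> y" .
      moreover have "inv (a \<ominus> a') \<otimes> (b' \<ominus> b) \<in> K"
        using K4 n unfolding a_minus_def by (simp add: subfield_closed)
      ultimately show False using not by blast
    qed
    then have "a = a'" "(b' \<ominus> b) \<otimes> y = \<zero>" using e by (simp, metis assms(1) l_null)
    then show "a = a' \<and> b = b'" using nz(2) integral by fastforce
  qed
qed

end

lemma independent_pair_spans_plane:
  assumes K: "subfield K R" "finite K" and x: "x \<in> carrier R" "y \<in> carrier R"
    and zw: "z \<in> plane K x y" "w \<in> plane K x y" and ind: "indep2 K z w"
  shows "plane K z w = plane K x y"
proof (rule card_subset_eq)
  show "finite (plane K x y)" using K(2) by (simp add: plane_def)
  show sub: "plane K z w \<subseteq> plane K x y" by (rule plane_subset_plane[OF K(1) x zw])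
  have "card (plane K x y) \<le> card (plane K z w)"
    using ind card_plane_le[OF K(2)] by (simp add: indep2_iff_card K(2))
  moreover have "card (plane K z w) \<le> card (plane K x y)"
    using sub \<open>finite (plane K x y)\<close> by (rule card_mono[rotated])
  ultimately show "card (plane K z w) = card (plane K x y)" by simp
qed

text \<open>
  Over \<open>K\<close> the pair \<open>z, w\<close> spans the same plane as \<open>x, y\<close>. In particular \<open>x\<close> and \<open>y\<close> are combinations
  of \<open>z\<close> and \<open>w\<close>, so the plane of \<open>z, w\<close> over \<open>M\<close> is at least as large as that of \<open>x, y\<close>.
  Geometrically: a line that is not contained in an element of the spread meets each of its elements
  in at most one point.
\<close>

lemma indep2_over_extension:
  assumes K: "subfield K R" and M: "subfield M R" "finite M" "K \<subseteq> M"
    and x: "x \<in> carrier R" "y \<in> carrier R" and xy: "indep2 M x y"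
    and zw: "z \<in> plane K x y" "w \<in> plane K x y" and ind: "indep2 K z w"
  shows "indep2 M z w"
proof -
  have zw_carrier: "z \<in> carrier R" "w \<in> carrier R" using zw plane_carrier[OF K x] by auto
  have "plane K z w \<subseteq> plane M z w" using M(3) by (auto simp: plane_def)
  moreover have "plane K z w = plane K x y"
    using independent_pair_spans_plane[OF K finite_subset[OF M(3,2)] x zw ind] .
  ultimately have "x \<in> plane M z w" "y \<in> plane M z w"
    using generators_in_plane[OF K x] by auto
  then have "plane M x y \<subseteq> plane M z w"
    using plane_subset_plane[OF M(1) zw_carrier] by blast
  then have "card (plane M x y) \<le> card (plane M z w)"
    using M(2) by (intro card_mono) (simp_all add: plane_def)
  then show ?thesis
    using xy card_plane_le[OF M(2), of z w] by (simp add: indep2_iff_card M(2))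
qed

end

text \<open>
  The tower \<open>K \<subseteq> M \<subseteq> R\<close> with a generator \<open>\<alpha>\<close> of the multiplicative group, where the sizes of \<open>K\<close> and
  \<open>M\<close> enter through the proportionality of powers of \<open>\<alpha>\<close>.
\<close>

locale singer_tower = field R for R (structure) +
  fixes K M :: "'a set" and \<alpha> :: 'a and L T :: nat
  assumes finite_R: "finite (carrier R)"
    and K: "subfield K R" and M: "subfield M R" and K_M: "K \<subseteq> M"
    and \<alpha>: "\<alpha> \<in> carrier R" "\<alpha> \<noteq> \<zero>"
    and powers: "\<lbrakk>x \<in> carrier R; x \<noteq> \<zero>\<rbrakk> \<Longrightarrow> \<exists>n::nat. x = \<alpha> [^] n"
    and proportional_K: "(\<exists>c\<in>K. \<alpha> [^] a = c \<otimes> \<alpha> [^] b) \<longleftrightarrow> [a = b] (mod L * T)"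
    and proportional_M: "(\<exists>c\<in>M. \<alpha> [^] a = c \<otimes> \<alpha> [^] b) \<longleftrightarrow> [a = b] (mod L)"
    and L: "2 \<le> L" and T: "1 \<le> T"
begin

definition cells :: "(nat \<times> nat) set" where
  "cells = {..<L} \<times> {..<T}"

text \<open>
  The row index is the exponent modulo \<open>L\<close>, so rows are classes of points that are
  proportional over \<open>M\<close>, and adding \<open>L\<close> to the exponent moves to the next column.
\<close>

definition point :: "nat \<times> nat \<Rightarrow> 'a" where
  "point p = \<alpha> [^] (fst p + L * snd p)"

definition line_cells :: "'a \<Rightarrow> 'a \<Rightarrow> (nat \<times> nat) set" where
  "line_cells x y = {p \<in> cells. point p \<in> plane K x y}"

text \<open>
  The lines that are not contained in a single element of the spread.
\<close>

definition transversal_lines :: "(nat \<times> nat) set set" where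
  "transversal_lines =
    {line_cells x y | x y. x \<in> carrier R - {\<zero>} \<and> y \<in> carrier R - {\<zero>} \<and> indep2 M x y}"

lemma finite_K: "finite K" and finite_M: "finite M"
  using finite_R subfieldE(3)[OF K] subfieldE(3)[OF M] finite_subset by auto

lemma power_nonzero: "\<alpha> [^] (n::nat) \<noteq> \<zero>"
  using \<alpha> by (induction n) (auto simp: integral_iff)

lemma point_carrier [simp]: "point p \<in> carrier R" and point_nonzero [simp]: "point p \<noteq> \<zero>"
  using \<alpha> power_nonzero by (simp_all add: point_def)

lemma indep2_K_point:
  assumes "p \<in> cells" "p' \<in> cells"
  shows "indep2 K (point p) (point p') \<longleftrightarrow> p \<noteq> p'"
proof -
  obtain i j i' j' where p: "p = (i, j)" "p' = (i', j')" by (cases p, cases p')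
  have bounds: "i < L" "j < T" "i' < L" "j' < T" using assms by (simp_all add: p cells_def)
  have lt: "a + L * b < L * T" if "a < L" "b < T" for a b
  proof -
    have "a + L * b < L * Suc b" using that by simp
    also have "\<dots> \<le> L * T" using that by (intro mult_le_mono2) simp
    finally show ?thesis .
  qed
  have "[i + L * j = i' + L * j'] (mod L * T) \<longleftrightarrow> i + L * j = i' + L * j'"
    using lt bounds by (simp add: cong_def)
  also have "\<dots> \<longleftrightarrow> p = p'"
  proof
    assume e: "i + L * j = i' + L * j'"
    have "i = i'" using arg_cong[OF e, of "\<lambda>n. n mod L"] bounds by simp
    then show "p = p'" using e bounds by (simp add: p)
  qed (simp add: p)
  finally show ?thesis
    unfolding indep2_iff_not_proportional[OF K point_carrier point_carrier point_nonzero point_nonzero]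
    by (simp add: point_def proportional_K p)
qed

lemma indep2_M_point:
  assumes "p \<in> cells" "p' \<in> cells"
  shows "indep2 M (point p) (point p') \<longleftrightarrow> fst p \<noteq> fst p'"
proof -
  have "[fst p + L * snd p = fst p' + L * snd p'] (mod L) \<longleftrightarrow> fst p = fst p'"
    using assms by (auto simp: cong_def cells_def)
  then show ?thesis
    unfolding indep2_iff_not_proportional[OF M point_carrier point_carrier point_nonzero point_nonzero]
    by (simp add: point_def proportional_M)
qed

lemma ex_point:
  assumes "x \<in> carrier R" "x \<noteq> \<zero>"
  obtains c p where "c \<in> K" "p \<in> cells" "x = c \<otimes> point p"
proof -
  obtain n where n: "x = \<alpha> [^] (n::nat)" using powers[OF assms] by blast
  define m where "m = n mod (L * T)"
  have "m < T * L" using L T by (simp add: m_def mult.commute)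
  then have cell: "(m mod L, m div L) \<in> cells"
    using L by (simp add: cells_def less_mult_imp_div_less)
  have "[n = m mod L + L * (m div L)] (mod L * T)" by (simp add: m_def cong_def)
  then obtain c where "c \<in> K" "x = c \<otimes> point (m mod L, m div L)"
    using proportional_K by (auto simp: n point_def)
  then show thesis using that cell by blast
qed

text \<open>
  Every nonzero vector of the plane is a nonzero scalar times a unique point, so the number \<open>n\<close> of
  points satisfies \<open>(|K| - 1) * n = |K|\<^sup>2 - 1\<close>.
\<close>

lemma card_line_cells:
  assumes x: "x \<in> carrier R" "y \<in> carrier R" and ind: "indep2 K x y"
  shows "card (line_cells x y) = card K + 1"
proof -
  have fin: "finite (line_cells x y)" by (simp add: line_cells_def cells_def)
  have zero: "\<zero> \<in> plane K x y"
    using x by (intro planeI[of \<zero> K \<zero>]) (simp_all add: subfield_closed(1)[OF K])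
  have "bij_betw (\<lambda>(c, p). c \<otimes> point p) ((K - {\<zero>}) \<times> line_cells x y) (plane K x y - {\<zero>})"
  proof (rule bij_betw_imageI)
    show "inj_on (\<lambda>(c, p). c \<otimes> point p) ((K - {\<zero>}) \<times> line_cells x y)"
    proof (rule inj_onI)
      fix s s'
      assume s: "s \<in> (K - {\<zero>}) \<times> line_cells x y" and s': "s' \<in> (K - {\<zero>}) \<times> line_cells x y"
        and "(\<lambda>(c, p). c \<otimes> point p) s = (\<lambda>(c, p). c \<otimes> point p) s'"
      then obtain c p c' p' where ss: "s = (c, p)" "s' = (c', p')" and eq: "c \<otimes> point p = c' \<otimes> point p'"
        by (cases s, cases s') simp
      have c: "c \<in> K" "c \<noteq> \<zero>" "c' \<in> K" "c' \<noteq> \<zero>"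
        and p: "p \<in> line_cells x y" "p' \<in> line_cells x y"
        using s s' by (simp_all add: ss)
      have cc: "c \<in> carrier R" "c' \<in> carrier R" "c \<in> Units R"
        using c subfield_closed(3)[OF K] by (auto simp: field_Units)
      have "point p = inv c \<otimes> (c \<otimes> point p)" using cc by (simp add: m_assoc[symmetric])
      also have "\<dots> = (inv c \<otimes> c') \<otimes> point p'" using cc by (simp add: eq m_assoc)
      finally have "\<not> indep2 K (point p) (point p')"
        unfolding indep2_iff_not_proportional[OF K point_carrier point_carrier point_nonzero point_nonzero]
        using c by (blast intro: subfield_closed[OF K])
      then have "p = p'" using p indep2_K_point by (simp add: line_cells_def)
      then have "c = c'" using eq cc m_rcancel[OF point_nonzero point_carrier] by auto
      then show "s = s'" using \<open>p = p'\<close> by (simp add: ss)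
    qed
    show "(\<lambda>(c, p). c \<otimes> point p) ` ((K - {\<zero>}) \<times> line_cells x y) = plane K x y - {\<zero>}"
    proof (intro equalityI subsetI)
      fix z assume "z \<in> (\<lambda>(c, p). c \<otimes> point p) ` ((K - {\<zero>}) \<times> line_cells x y)"
      then obtain c p where c: "c \<in> K" "c \<noteq> \<zero>" and p: "p \<in> line_cells x y" and z: "z = c \<otimes> point p"
        by auto
      have "z \<noteq> \<zero>" using c subfield_closed(3)[OF K] by (simp add: z integral_iff)
      then show "z \<in> plane K x y - {\<zero>}"
        using c p plane_smult[OF K x] by (simp add: z line_cells_def)
    next
      fix z assume z: "z \<in> plane K x y - {\<zero>}"
      then have "z \<in> carrier R" "z \<noteq> \<zero>" using plane_carrier[OF K x] by auto
      then obtain c p where c: "c \<in> K" and p: "p \<in> cells" and zc: "z = c \<otimes> point p"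
        by (rule ex_point)
      have c0: "c \<noteq> \<zero>" using zc \<open>z \<noteq> \<zero>\<close> by auto
      then have cU: "c \<in> Units R" "c \<in> carrier R"
        using c subfield_closed(3)[OF K] by (simp_all add: field_Units)
      have "point p = inv c \<otimes> z" using cU by (simp add: zc m_assoc[symmetric])
      then have "point p \<in> plane K x y"
        using z plane_smult[OF K x] subfield_closed(7)[OF K c c0] by simp
      then show "z \<in> (\<lambda>(c, p). c \<otimes> point p) ` ((K - {\<zero>}) \<times> line_cells x y)"
        using c c0 p zc by (intro image_eqI[of _ _ "(c, p)"]) (simp_all add: line_cells_def)
    qed
  qed
  from bij_betw_same_card[OF this]
  have "(card K - 1) * card (line_cells x y) = card K * card K - 1"
    using ind finite_K zero subfield_closed(1)[OF K]
    by (simp add: card_cartesian_product indep2_iff_card card_Diff_singleton)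
  also have "\<dots> = (card K - 1) * (card K + 1)"
    by (simp add: algebra_simps diff_mult_distrib)
  finally have *: "(card K - 1) * card (line_cells x y) = (card K - 1) * (card K + 1)" .
  have "card {\<zero>, \<one>} \<le> card K"
    using finite_K subfield_closed(1,2)[OF K] by (intro card_mono) auto
  then have "card K - 1 > 0" by simp
  then show ?thesis using * by (simp only: mult_cancel1) simp
qed

lemma plane_eq_of_common_cells:
  assumes x: "x \<in> carrier R" "y \<in> carrier R"
    and p: "p \<in> line_cells x y" "p' \<in> line_cells x y" "p \<noteq> p'"
  shows "plane K (point p) (point p') = plane K x y"
proof (rule independent_pair_spans_plane[OF K finite_K x])
  show "indep2 K (point p) (point p')" using p by (subst indep2_K_point) (auto simp: line_cells_def)
qed (use p in \<open>auto simp: line_cells_def\<close>)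

lemma indep2_M_imp_K:
  assumes "x \<in> carrier R" "y \<in> carrier R" "x \<noteq> \<zero>" "y \<noteq> \<zero>" "indep2 M x y"
  shows "indep2 K x y"
  using assms K_M by (auto simp: indep2_iff_not_proportional[OF K] indep2_iff_not_proportional[OF M])

lemma indep2_scale:
  assumes [simp]: "x \<in> carrier R" "y \<in> carrier R" "u \<in> carrier R"
    and nz: "x \<noteq> \<zero>" "y \<noteq> \<zero>" "u \<noteq> \<zero>" and ind: "indep2 M x y"
  shows "indep2 M (u \<otimes> x) (u \<otimes> y)"
proof -
  have "x = c \<otimes> y" if "c \<in> M" "u \<otimes> x = c \<otimes> (u \<otimes> y)" for c
  proof -
    have [simp]: "c \<in> carrier R" using that subfield_closed(3)[OF M] by blast
    have "u \<otimes> x = u \<otimes> (c \<otimes> y)" using that by (simp add: m_lcomm)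
    then show ?thesis using nz m_lcancel by simp
  qed
  then show ?thesis
    using ind nz
    by (subst indep2_iff_not_proportional[OF M])
      (auto simp: integral_iff indep2_iff_not_proportional[OF M])
qed

text \<open>
  Multiplication by \<open>\<alpha> ^ L\<close> realises the row shift. The scalar \<open>c\<close> accounts for the wrap-around,
  where the exponents differ by a multiple of \<open>L * T\<close>.
\<close>

lemma shift_point:
  assumes "p \<in> cells"
  obtains c where "c \<in> K" "point (row_shift T t p) = c \<otimes> (\<alpha> [^] (L * t) \<otimes> point p)"
proof -
  obtain i j where p: "p = (i, j)" by (cases p)
  have "[(j + t) mod T = j + t] (mod T)" by (simp add: cong_def)
  then have "[L * ((j + t) mod T) = L * (j + t)] (mod L * T)"
    by (simp add: cong_def mod_mult_mult1)
  then have "[i + L * ((j + t) mod T) = i + L * (j + t)] (mod L * T)"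
    by (simp only: cong_add_lcancel_nat)
  then have "[i + L * ((j + t) mod T) = L * t + (i + L * j)] (mod L * T)"
    by (simp add: algebra_simps)
  then obtain c where "c \<in> K" "\<alpha> [^] (i + L * ((j + t) mod T)) = c \<otimes> \<alpha> [^] (L * t + (i + L * j))"
    using proportional_K by blast
  then show thesis using that \<alpha> by (simp add: p point_def nat_pow_mult)
qed

lemma row_shift_line_cells:
  assumes x: "x \<in> carrier R - {\<zero>}" "y \<in> carrier R - {\<zero>}" and ind: "indep2 M x y"
  shows "row_shift T t ` line_cells x y = line_cells (\<alpha> [^] (L * t) \<otimes> x) (\<alpha> [^] (L * t) \<otimes> y)"
    and "row_shift T t ` line_cells x y \<in> transversal_lines"
proof -
  let ?u = "\<alpha> [^] (L * t)"
  have u: "?u \<in> carrier R" "?u \<noteq> \<zero>" using \<alpha> power_nonzero by auto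
  have ux: "?u \<otimes> x \<in> carrier R - {\<zero>}" "?u \<otimes> y \<in> carrier R - {\<zero>}"
    using u x by (auto simp: integral_iff)
  have ind': "indep2 M (?u \<otimes> x) (?u \<otimes> y)" using indep2_scale u x ind by simp
  \<comment> \<open>One inclusion suffices, since both sides have \<open>card K + 1\<close> cells.\<close>
  show eq: "row_shift T t ` line_cells x y = line_cells (?u \<otimes> x) (?u \<otimes> y)"
  proof (rule card_subset_eq)
    show "finite (line_cells (?u \<otimes> x) (?u \<otimes> y))" by (simp add: line_cells_def cells_def)
    show "row_shift T t ` line_cells x y \<subseteq> line_cells (?u \<otimes> x) (?u \<otimes> y)"
    proof (rule image_subsetI)
      fix p assume p: "p \<in> line_cells x y"
      then have cell: "p \<in> cells" by (simp add: line_cells_def)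
      obtain c where "c \<in> K" "point (row_shift T t p) = c \<otimes> (?u \<otimes> point p)"
        using shift_point[OF cell] .
      moreover have "?u \<otimes> point p \<in> plane K (?u \<otimes> x) (?u \<otimes> y)"
        using p x u by (intro plane_translate[OF K]) (auto simp: line_cells_def)
      ultimately have "point (row_shift T t p) \<in> plane K (?u \<otimes> x) (?u \<otimes> y)"
        using plane_smult[OF K] ux by simp
      moreover have "row_shift T t p \<in> cells" using cell T by (auto simp: cells_def)
      ultimately show "row_shift T t p \<in> line_cells (?u \<otimes> x) (?u \<otimes> y)"
        by (simp add: line_cells_def)
    qed
    have "inj_on (row_shift T t) (line_cells x y)"
      by (rule inj_on_subset[OF inj_on_row_shift[of T t "{..<L}"]]) (auto simp: line_cells_def cells_def)
    then show "card (row_shift T t ` line_cells x y) = card (line_cells (?u \<otimes> x) (?u \<otimes> y))"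
      using x ux ind ind' by (simp add: card_image card_line_cells indep2_M_imp_K)
  qed
  show "row_shift T t ` line_cells x y \<in> transversal_lines"
    unfolding eq transversal_lines_def using ux ind' by blast
qed

theorem cyclic_row_design_transversal_lines:
  "cyclic_row_design L T (card K + 1) transversal_lines"
proof
  show "2 \<le> L" "1 \<le> T" by (rule L, rule T)
  have "K \<noteq> {}" using subfield_closed(1)[OF K] by blast
  then show "2 \<le> card K + 1" using finite_K by (simp add: Suc_le_eq card_gt_0_iff)
next
  fix B assume "B \<in> transversal_lines"
  then show "B \<subseteq> {..<L} \<times> {..<T}"
    unfolding transversal_lines_def line_cells_def cells_def by blast
next
  fix B assume "B \<in> transversal_lines"
  then show "card B = card K + 1"
    by (auto simp: transversal_lines_def card_line_cells indep2_M_imp_K)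
next
  fix B p p'
  assume "B \<in> transversal_lines" and p: "p \<in> B" "p' \<in> B" "fst p = fst p'"
  then obtain x y where x: "x \<in> carrier R" "y \<in> carrier R" "indep2 M x y" and B: "B = line_cells x y"
    unfolding transversal_lines_def by blast
  have cells: "p \<in> cells" "p' \<in> cells" using p by (auto simp: B line_cells_def)
  show "p = p'"
  proof (rule ccontr)
    assume "p \<noteq> p'"
    then have "indep2 K (point p) (point p')" using cells by (simp add: indep2_K_point)
    then have "indep2 M (point p) (point p')"
      using indep2_over_extension[OF K M finite_M K_M x] p by (simp add: B line_cells_def)
    then show False using p(3) cells by (simp add: indep2_M_point)
  qed
next
  fix p p' :: "nat \<times> nat"
  assume "p \<in> {..<L} \<times> {..<T}" "p' \<in> {..<L} \<times> {..<T}" and ne: "fst p \<noteq> fst p'"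
  then have cells: "p \<in> cells" "p' \<in> cells" by (simp_all add: cells_def)
  have "line_cells (point p) (point p') \<in> transversal_lines"
    unfolding transversal_lines_def
    by (intro CollectI exI[of _ "point p"] exI[of _ "point p'"]) (simp add: indep2_M_point[OF cells] ne)
  moreover have "p \<in> line_cells (point p) (point p')" "p' \<in> line_cells (point p) (point p')"
    using cells generators_in_plane[OF K point_carrier point_carrier] by (simp_all add: line_cells_def)
  ultimately show "\<exists>B\<in>transversal_lines. p \<in> B \<and> p' \<in> B" by blast
next
  fix A B p p'
  assume "A \<in> transversal_lines" "B \<in> transversal_lines" and p: "p \<in> A \<inter> B" "p' \<in> A \<inter> B" "p \<noteq> p'"
  then obtain x y x' y' where x: "x \<in> carrier R" "y \<in> carrier R" and A: "A = line_cells x y"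
    and x': "x' \<in> carrier R" "y' \<in> carrier R" and B: "B = line_cells x' y'"
    unfolding transversal_lines_def by blast
  have "plane K x y = plane K x' y'"
    using plane_eq_of_common_cells[OF x] plane_eq_of_common_cells[OF x'] p unfolding A B by blast
  then show "A = B" by (simp add: A B line_cells_def)
next
  fix B t assume "B \<in> transversal_lines"
  then show "row_shift T t ` B \<in> transversal_lines"
    using row_shift_line_cells(2) by (auto simp: transversal_lines_def)
qed

end

section \<open>Optimal codes from projective lines\<close>

theorem theorem3p2:
  fixes q d k :: nat
  assumes "primepow q"
    and "d \<ge> 1"
    and "d + 1 dvd k + 1" and "d + 1 < k + 1"
  shows "\<exists>C. J_optimal_ideal_ooc_2d (theta q k div theta q d) (theta q d) (q + 1) 1 C"
proof -
  obtain p e where p: "Factorial_Ring.prime p" and e: "e > 0" and q: "q = p ^ e"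
    using assms(1) by (auto simp: primepow_def)
  have q2: "q \<ge> 2" using primepow_gt_Suc_0[OF assms(1)] by simp
  define s where "s = q - 1"
  define T where "T = theta q d"
  define L where "L = theta q k div theta q d"
  have LT: "L * T = theta q k"
    using theta_dvd_theta[OF q2 assms(3)] by (simp add: L_def T_def)
  have s: "Suc s = q" "s > 0" using q2 by (auto simp: s_def)
  have Ts: "T * s = q ^ (d + 1) - 1" and LTs: "L * T * s = q ^ (k + 1) - 1"
    using theta_mult[of q d] theta_mult[of q k] LT by (simp_all add: T_def s_def)
  have d_k: "q ^ (d + 1) < q ^ (k + 1)" using q2 assms(4) by (intro power_strict_increasing) auto
  have d1: "1 < q ^ (d + 1)" using q2 by (intro one_less_power) auto
  have T: "1 \<le> T" using Ts d1 by (cases T) auto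
  have "T * s < L * (T * s)" using Ts LTs d_k d1 by (simp only: mult.assoc)
  then have L: "2 \<le> L" by (cases L) auto

  obtain R :: "((int list \<times> nat) multiset \<Rightarrow> int) ring"
    where R: "field R" and card_R: "card (carrier R) = p ^ (e * (k + 1))"
      and char: "[p] \<cdot>\<^bsub>R\<^esub> \<one>\<^bsub>R\<^esub> = \<zero>\<^bsub>R\<^esub>"
      and fixed: "\<And>m. \<lbrakk>m > 0; m dvd e * (k + 1)\<rbrakk> \<Longrightarrow> card (cring.frobenius_fixed R (p ^ m)) = p ^ m"
    using ex_finite_field[OF p, of "e * (k + 1)"] e by auto
  interpret field R by (rule R)
  \<comment> \<open>The order of the multiplicative group is the number of rows times columns times nonzero scalars.\<close>
  have card_R': "card (carrier R) - 1 = L * T * s"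
    by (simp only: card_R LTs q power_mult)
  have fin: "finite (carrier R)"
    using card_R p by (intro card_ge_0_finite) (simp add: prime_gt_0_nat)
  let ?K = "frobenius_fixed (p ^ e)" and ?M = "frobenius_fixed (p ^ (e * (d + 1)))"
  have K: "?K = frobenius_fixed (Suc s)" by (simp only: s q)
  have "p ^ (e * (d + 1)) = q ^ (d + 1)" by (simp only: q power_mult)
  then have "p ^ (e * (d + 1)) = Suc (T * s)" using Ts d1 by linarith
  then have M: "?M = frobenius_fixed (Suc (T * s))" by (rule arg_cong)
  have card_K: "card ?K = q" using fixed[of e] e by (simp add: q)
  obtain \<alpha> where \<alpha>: "\<alpha> \<in> carrier R" "\<alpha> \<noteq> \<zero>\<^bsub>R\<^esub>"
    and powers: "\<And>x. \<lbrakk>x \<in> carrier R; x \<noteq> \<zero>\<^bsub>R\<^esub>\<rbrakk> \<Longrightarrow> \<exists>n::nat. x = \<alpha> [^]\<^bsub>R\<^esub> n"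
    and prim: "\<And>a b::nat. \<alpha> [^]\<^bsub>R\<^esub> a = \<alpha> [^]\<^bsub>R\<^esub> b \<longleftrightarrow> [a = b] (mod L * T * s)"
    using ex_primitive_element[OF fin] unfolding card_R' by blast
  interpret singer_tower R ?K ?M \<alpha> L T
  proof (intro singer_tower.intro singer_tower_axioms.intro)
    show "subfield ?K R" "subfield ?M R" by (rule subfield_frobenius_fixed[OF p char])+
    show "?K \<subseteq> ?M" by (rule frobenius_fixed_mono) simp
    show "(\<exists>c\<in>?K. \<alpha> [^]\<^bsub>R\<^esub> a = c \<otimes>\<^bsub>R\<^esub> \<alpha> [^]\<^bsub>R\<^esub> b) \<longleftrightarrow> [a = b] (mod L * T)" for a b :: nat
      unfolding K by (rule proportional_powers_over_frobenius_fixed[OF \<alpha> prim s(2)])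
    show "(\<exists>c\<in>?M. \<alpha> [^]\<^bsub>R\<^esub> a = c \<otimes>\<^bsub>R\<^esub> \<alpha> [^]\<^bsub>R\<^esub> b) \<longleftrightarrow> [a = b] (mod L)" for a b :: nat
      unfolding M using prim T s(2)
      by (intro proportional_powers_over_frobenius_fixed[OF \<alpha>]) (simp_all add: mult.assoc)
  qed (use R fin \<alpha> powers L T in auto)
  interpret cyclic_row_design L T "q + 1" transversal_lines
    using cyclic_row_design_transversal_lines by (simp add: card_K)
  have "q dvd L * T - T"
  proof -
    \<comment> \<open>The factor \<open>s = q - 1\<close> is coprime to \<open>q\<close> and can be dropped.\<close>
    have "(L * T - T) * s = q ^ (k + 1) - q ^ (d + 1)"
      using Ts LTs d1 by (simp add: diff_mult_distrib)
    moreover have "q dvd q ^ (k + 1) - q ^ (d + 1)" by (intro dvd_diff_nat) simp_all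
    moreover have "coprime q s" using s(1) coprime_Suc_left_nat by metis
    ultimately show ?thesis by (metis coprime_dvd_mult_left_iff)
  qed
  then show ?thesis
    using ex_J_optimal_code unfolding L_def T_def by simp
qed

end
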